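(* Let $f\colon X\to Y$ be a continuous map between topological spaces which is locally open onto its image. Up to isomorphism, there is a unique factorization $f=pq$ in the category of topological spaces and continuous maps into an open surjection $q\colon X\to E$ and a filtered map $p\colon E\to Y$. If $f$ is filtered, then every point $x\in X$ has an open neighbourhood which is mapped by $f$ homeomorphically onto a subspace of $Y$.
   Context: A continuous map $f\colon X\to Y$ is locally open onto its image if every $x\in X$ admits an open neighbourhood $U$ such that the induced map $U\to f(U)$ is open onto the subspace $f(U)$ of $Y$. For $x\in X$ let $\mathcal U(x)$ be the neighbourhood filter of $x$, and let $f(\mathcal U(x))=\{B\subset Y : f^{-1}(B)\in\mathcal U(x)\}$ be its image filter on $Y$. The map $f$ is filtered if it is continuous, locally open onto its image, and the map $x\mapsto (f(x),f(\mathcal U(x)))$ is injective on $X$. Uniqueness up to isomorphism means: if $f=pq=p'q'$ with $q\colon X\to E$, $q'\colon X\to E'$ (continuous) open surjections and $p\colon E\to Y$, $p'\colon E'\to Y$ filtered, then there is a homeomorphism $h\colon E\to E'$ with $q'=hq$ and $p=p'h$. *)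

theory Defs
  imports "HOL-Analysis.Analysis"
begin

definition locally_open_onto_image :: "'a topology \<Rightarrow> 'b topology \<Rightarrow> ('a \<Rightarrow> 'b) \<Rightarrow> bool" where
  "locally_open_onto_image X Y f \<longleftrightarrow>
     (\<forall>x \<in> topspace X. \<exists>U. openin X U \<and> x \<in> U \<and>
        open_map (subtopology X U) (subtopology Y (f ` U)) f)"

text \<open>
  For a point \<open>x\<close> of \<open>X\<close>, \<open>nhdsin X x\<close> is the neighbourhood filter of \<open>x\<close>, regarded as a filter
  on the whole underlying type; \<open>filtermap f (nhdsin X x)\<close> is therefore a filter on the
  whole type underlying \<open>Y\<close>. For \<open>f\<close> mapping \<open>X\<close> into \<open>Y\<close>, the space of \<open>Y\<close> belongs to that
  filter, so it carries the same information as its trace on \<open>Y\<close>, the image filter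
  consisting of the subsets \<open>B\<close> of \<open>Y\<close> whose preimage is a neighbourhood of \<open>x\<close>.
\<close>

definition filtered_map :: "'a topology \<Rightarrow> 'b topology \<Rightarrow> ('a \<Rightarrow> 'b) \<Rightarrow> bool" where
  "filtered_map X Y f \<longleftrightarrow>
     continuous_map X Y f \<and> locally_open_onto_image X Y f \<and>
     inj_on (\<lambda>x. (f x, filtermap f (nhdsin X x))) (topspace X)"

definition open_filtered_factorization ::
  "'a topology \<Rightarrow> 'b topology \<Rightarrow> ('a \<Rightarrow> 'b) \<Rightarrow> 'e topology \<Rightarrow> ('a \<Rightarrow> 'e) \<Rightarrow> ('e \<Rightarrow> 'b) \<Rightarrow> bool" where
  "open_filtered_factorization X Y f E q p \<longleftrightarrow>
     continuous_map X E q \<and> open_map X E q \<and> q ` topspace X = topspace E \<and>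
     filtered_map E Y p \<and>
     (\<forall>x \<in> topspace X. f x = p (q x))"

end

theory Submission
  imports Defs
begin

text \<open>
  On an open set \<open>U\<close> on which \<open>f\<close> is open onto \<open>f ` U\<close>, the image filter of a point \<open>x\<close> is the
  neighbourhood filter of \<open>f x\<close> in the subspace \<open>f ` U\<close>, that is, the germ of \<open>f ` U\<close> at \<open>f x\<close>.
  If two points have the same value and the same image filter, the corresponding germs agree, hence
  the images agree on a neighbourhood of the common value, and nearby points with the same value
  again have the same image filter. Identifying points with the same value and image filter
  is therefore an open equivalence relation, and its quotient map is \<open>q\<close>. Conversely, an open
  surjection preserves neighbourhood filters, so in every factorization the fibres of \<open>q\<close> are the
  classes of this relation.
\<close>

section \<open>Neighbourhood filters in subspaces and under open maps\<close>

lemma filtermap_nhdsin_open_map: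
  assumes "continuous_map X Y f" "open_map X Y f" "x \<in> topspace X"
  shows "filtermap f (nhdsin X x) = nhdsin Y (f x)"
proof (rule filter_eq_iff[THEN iffD2, rule_format])
  fix P
  have fx: "f x \<in> topspace Y"
    using assms continuous_map_image_subset_topspace by blast
  show "eventually P (filtermap f (nhdsin X x)) \<longleftrightarrow> eventually P (nhdsin Y (f x))"
  proof
    assume "eventually P (filtermap f (nhdsin X x))"
    then obtain S where "openin X S" "x \<in> S" "\<forall>z\<in>S. P (f z)"
      using assms(3) by (auto simp: eventually_filtermap eventually_nhdsin)
    then have "openin Y (f ` S)" "f x \<in> f ` S" "\<forall>z\<in>f ` S. P z"
      using assms(2) by (auto simp: open_map_def)
    then show "eventually P (nhdsin Y (f x))"
      unfolding eventually_nhdsin by blast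
  next
    assume "eventually P (nhdsin Y (f x))"
    then obtain S where S: "openin Y S" "f x \<in> S" "\<forall>z\<in>S. P z"
      using fx by (auto simp: eventually_nhdsin)
    have "openin X {z \<in> topspace X. f z \<in> S}"
      using S(1) assms(1) openin_continuous_map_preimage by blast
    with S assms(3) show "eventually P (filtermap f (nhdsin X x))"
      unfolding eventually_filtermap eventually_nhdsin
      by (intro disjI2 exI[of _ "{z \<in> topspace X. f z \<in> S}"]) auto
  qed
qed

lemma nhdsin_open_subtopology:
  assumes "openin X U" "x \<in> U"
  shows "nhdsin (subtopology X U) x = nhdsin X x"
proof (rule filter_eq_iff[THEN iffD2, rule_format])
  fix P
  have x: "x \<in> topspace X" "x \<in> topspace (subtopology X U)"
    using assms openin_subset by auto
  show "eventually P (nhdsin (subtopology X U) x) \<longleftrightarrow> eventually P (nhdsin X x)"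
  proof
    assume "eventually P (nhdsin (subtopology X U) x)"
    then show "eventually P (nhdsin X x)"
      using x assms(1) by (auto simp: eventually_nhdsin openin_open_subtopology)
  next
    assume "eventually P (nhdsin X x)"
    then obtain S where "openin X S" "x \<in> S" "\<forall>z\<in>S. P z"
      using x by (auto simp: eventually_nhdsin)
    then have "openin (subtopology X U) (S \<inter> U)" "x \<in> S \<inter> U" "\<forall>z\<in>S \<inter> U. P z"
      using assms by (auto simp: openin_subtopology)
    then show "eventually P (nhdsin (subtopology X U) x)"
      unfolding eventually_nhdsin by blast
  qed
qed

lemma eventually_nhdsin_subtopology:
  assumes "x \<in> topspace X" "x \<in> S"
  shows "eventually P (nhdsin (subtopology X S) x) \<longleftrightarrow>
    (\<exists>W. openin X W \<and> x \<in> W \<and> (\<forall>z\<in>W \<inter> S. P z))"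
  using assms unfolding eventually_nhdsin openin_subtopology by auto

text \<open>Each of \<open>S\<close> and \<open>T\<close> belongs to its own filter, so equality of
  the filters puts each into the other's, and near \<open>x\<close> each set contains the other. The
  gain is that the equation \<open>W \<inter> S = W \<inter> T\<close> no longer mentions
  \<open>x\<close>: it yields equal filters at every other common point of \<open>S\<close> and
  \<open>T\<close> in \<open>W\<close> too.\<close>

lemma nhdsin_subtopology_eq_iff:
  assumes "x \<in> topspace X" "x \<in> S" "x \<in> T"
  shows "nhdsin (subtopology X S) x = nhdsin (subtopology X T) x \<longleftrightarrow>
    (\<exists>W. openin X W \<and> x \<in> W \<and> W \<inter> S = W \<inter> T)"
proof
  assume eq: "nhdsin (subtopology X S) x = nhdsin (subtopology X T) x"
  note ev = eventually_nhdsin_subtopology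
  have "eventually (\<lambda>z. z \<in> S) (nhdsin (subtopology X S) x)"
    using assms by (auto simp: ev)
  then obtain V where V: "openin X V" "x \<in> V" "\<forall>z\<in>V \<inter> T. z \<in> S"
    unfolding eq using assms by (auto simp: ev)
  have "eventually (\<lambda>z. z \<in> T) (nhdsin (subtopology X T) x)"
    using assms by (auto simp: ev)
  then obtain W where W: "openin X W" "x \<in> W" "\<forall>z\<in>W \<inter> S. z \<in> T"
    unfolding eq[symmetric] using assms by (auto simp: ev)
  show "\<exists>W. openin X W \<and> x \<in> W \<and> W \<inter> S = W \<inter> T"
    using V W by (intro exI[of _ "V \<inter> W"]) auto
next
  assume "\<exists>W. openin X W \<and> x \<in> W \<and> W \<inter> S = W \<inter> T"
  then obtain W where W: "openin X W" "x \<in> W" "W \<inter> S = W \<inter> T"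
    by blast
  have *: "eventually P (nhdsin (subtopology X B) x)"
    if P: "eventually P (nhdsin (subtopology X A) x)" and x: "x \<in> A" "x \<in> B"
      and AB: "W \<inter> A = W \<inter> B" for P A B
  proof -
    obtain V where "openin X V" "x \<in> V" "\<forall>z\<in>V \<inter> A. P z"
      using P x assms(1) by (auto simp: eventually_nhdsin_subtopology)
    with W AB have "openin X (V \<inter> W)" "x \<in> V \<inter> W" "\<forall>z\<in>V \<inter> W \<inter> B. P z"
      by auto
    then show ?thesis
      using x assms(1) by (auto simp: eventually_nhdsin_subtopology)
  qed
  show "nhdsin (subtopology X S) x = nhdsin (subtopology X T) x"
    using *[of _ S T] *[of _ T S] W(3) assms by (auto simp: filter_eq_iff)
qed

text \<open>Restricted to \<open>U\<close>, the map is continuous and open onto its image, and the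
  open set \<open>U\<close> does not change the neighbourhood filter of \<open>x\<close>. Hence the
  image filter depends on \<open>x\<close> only through \<open>f x\<close>, with one and the same
  \<open>U\<close> for all its points.\<close>

lemma filtermap_nhdsin_locally_open:
  assumes "continuous_map X Y f" "openin X U" "x \<in> U"
    and "open_map (subtopology X U) (subtopology Y (f ` U)) f"
  shows "filtermap f (nhdsin X x) = nhdsin (subtopology Y (f ` U)) (f x)"
proof -
  have "continuous_map (subtopology X U) (subtopology Y (f ` U)) f"
    using assms(1) by (auto simp: continuous_map_in_subtopology continuous_map_from_subtopology)
  moreover have "x \<in> topspace (subtopology X U)"
    using assms openin_subset by auto
  ultimately show ?thesis
    using filtermap_nhdsin_open_map[OF _ assms(4)] nhdsin_open_subtopology[OF assms(2,3)] by metis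
qed

lemma open_map_onto_image_subset:
  assumes "open_map (subtopology X U) (subtopology Y (f ` U)) f" "openin X V" "openin X U" "V \<subseteq> U"
  shows "open_map (subtopology X V) (subtopology Y (f ` V)) f"
  unfolding open_map_def
proof (intro allI impI)
  fix S assume S: "openin (subtopology X V) S"
  then have "openin (subtopology X U) S" and SV: "S \<subseteq> V"
    using assms by (auto simp: openin_open_subtopology)
  then have "openin (subtopology Y (f ` U)) (f ` S)"
    using assms(1) by (simp add: open_map_def)
  then obtain W where "openin Y W" "f ` S = W \<inter> f ` U"
    by (auto simp: openin_subtopology)
  then have "openin Y W \<and> f ` S = W \<inter> f ` V"
    using SV assms(4) by blast
  then show "openin (subtopology Y (f ` V)) (f ` S)"
    by (auto simp: openin_subtopology)
qed

text \<open>Openness onto the image passes to smaller open sets, so the witnessing neighbourhood may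
  be cut down to lie in any prescribed open neighbourhood.\<close>

lemma locally_open_onto_image_small:
  assumes "locally_open_onto_image X Y f" "openin X V" "x \<in> V"
  obtains U where "openin X U" "x \<in> U" "U \<subseteq> V"
    "open_map (subtopology X U) (subtopology Y (f ` U)) f"
proof -
  have "x \<in> topspace X"
    using assms openin_subset by blast
  then obtain U where U: "openin X U" "x \<in> U"
      "open_map (subtopology X U) (subtopology Y (f ` U)) f"
    using assms(1) unfolding locally_open_onto_image_def by blast
  show ?thesis
    using that[of "U \<inter> V"] U assms open_map_onto_image_subset[OF U(3), of "U \<inter> V"] by auto
qed

section \<open>Equality of germs as an open equivalence relation\<close>

definition germ :: "'a topology \<Rightarrow> ('a \<Rightarrow> 'b) \<Rightarrow> 'a \<Rightarrow> 'b \<times> 'b filter" where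
  "germ X f x = (f x, filtermap f (nhdsin X x))"

lemma germ_openin_saturation:
  assumes f: "continuous_map X Y f" "locally_open_onto_image X Y f" and U: "openin X U"
  shows "openin X {y \<in> topspace X. \<exists>x\<in>U. germ X f x = germ X f y}" (is "openin X ?S")
proof (subst openin_subopen, intro ballI)
  fix y assume "y \<in> ?S"
  then obtain x where x: "x \<in> U" and g: "germ X f x = germ X f y" and y: "y \<in> topspace X"
    by blast
  then have fxy: "f x = f y"
    by (simp add: germ_def)
  \<comment> \<open>\<open>A\<close> is chosen inside \<open>U\<close> so that the partner
    \<open>w\<close> found below for a point \<open>z\<close> near \<open>y\<close> lies in
    \<open>U\<close>.\<close>
  obtain A where A: "openin X A" "x \<in> A" "A \<subseteq> U"
      "open_map (subtopology X A) (subtopology Y (f ` A)) f"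
    using locally_open_onto_image_small[OF f(2) U x] .
  obtain B where B: "openin X B" "y \<in> B"
      "open_map (subtopology X B) (subtopology Y (f ` B)) f"
    using f(2) y unfolding locally_open_onto_image_def by blast
  note nA = filtermap_nhdsin_locally_open[OF f(1) A(1) _ A(4)]
  note nB = filtermap_nhdsin_locally_open[OF f(1) B(1) _ B(3)]
  have fY: "f z \<in> topspace Y" if "z \<in> topspace X" for z
    using that f(1) continuous_map_image_subset_topspace by blast
  have "nhdsin (subtopology Y (f ` A)) (f y) = nhdsin (subtopology Y (f ` B)) (f y)"
    using g nA[OF A(2)] nB[OF B(2)] fxy by (simp add: germ_def)
  then obtain W where W: "openin Y W" "f y \<in> W" "W \<inter> f ` A = W \<inter> f ` B"
    using nhdsin_subtopology_eq_iff[of "f y" Y "f ` A" "f ` B"] fY[OF y] A(2) B(2) fxy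
    by (metis imageI)
  \<comment> \<open>On \<open>W\<close> the two images agree, so each point of \<open>?T\<close> has
    a point of \<open>A\<close> with the same value under \<open>f\<close>.\<close>
  let ?T = "B \<inter> {z \<in> topspace X. f z \<in> W}"
  have "openin X ?T"
    using B(1) W(1) f(1) openin_continuous_map_preimage by blast
  moreover have "?T \<subseteq> ?S"
  proof
    fix z assume z: "z \<in> ?T"
    then have "f z \<in> W \<inter> f ` A"
      unfolding W(3) by simp
    then obtain w where w: "w \<in> A" "f w = f z"
      by auto
    \<comment> \<open>The same \<open>W\<close> that came from the value \<open>f y\<close> serves
      at \<open>f z\<close>; this is how equality of germs spreads from \<open>y\<close> to its
      neighbours.\<close>
    have "nhdsin (subtopology Y (f ` A)) (f z) = nhdsin (subtopology Y (f ` B)) (f z)"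
      using nhdsin_subtopology_eq_iff[of "f z" Y "f ` A" "f ` B"] fY[of z] z w W
      by (metis (no_types, lifting) Int_iff imageI mem_Collect_eq)
    then have "germ X f w = germ X f z"
      using nA[OF w(1)] nB[of z] z w by (simp add: germ_def)
    with w(1) A(3) z show "z \<in> ?S"
      by blast
  qed
  ultimately show "\<exists>T. openin X T \<and> y \<in> T \<and> T \<subseteq> ?S"
    using B(2) y W(2) by blast
qed

section \<open>Quotient topologies and their comparison\<close>

definition pushforward_topology :: "'a topology \<Rightarrow> ('a \<Rightarrow> 'e) \<Rightarrow> 'e topology" where
  "pushforward_topology X q =
     topology (\<lambda>V. V \<subseteq> q ` topspace X \<and> openin X {x \<in> topspace X. q x \<in> V})"

lemma openin_pushforward_topology:
  "openin (pushforward_topology X q) V \<longleftrightarrow>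
     V \<subseteq> q ` topspace X \<and> openin X {x \<in> topspace X. q x \<in> V}"
proof -
  have "istopology (\<lambda>V. V \<subseteq> q ` topspace X \<and> openin X {x \<in> topspace X. q x \<in> V})"
    unfolding istopology_def
  proof (intro conjI allI impI)
    fix S T
    assume *: "S \<subseteq> q ` topspace X \<and> openin X {x \<in> topspace X. q x \<in> S}"
      "T \<subseteq> q ` topspace X \<and> openin X {x \<in> topspace X. q x \<in> T}"
    have "{x \<in> topspace X. q x \<in> S \<inter> T} =
        {x \<in> topspace X. q x \<in> S} \<inter> {x \<in> topspace X. q x \<in> T}"
      by auto
    with * show "openin X {x \<in> topspace X. q x \<in> S \<inter> T}"
      by auto
    show "S \<inter> T \<subseteq> q ` topspace X"
      using * by auto
  next
    fix K
    assume *: "\<forall>V\<in>K. V \<subseteq> q ` topspace X \<and> openin X {x \<in> topspace X. q x \<in> V}"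
    have "{x \<in> topspace X. q x \<in> \<Union>K} = (\<Union>V\<in>K. {x \<in> topspace X. q x \<in> V})"
      by auto
    with * show "openin X {x \<in> topspace X. q x \<in> \<Union>K}"
      by auto
    show "\<Union>K \<subseteq> q ` topspace X"
      using * by auto
  qed
  then show ?thesis
    by (simp add: pushforward_topology_def topology_inverse')
qed

lemma topspace_pushforward_topology: "topspace (pushforward_topology X q) = q ` topspace X"
proof (rule antisym)
  show "topspace (pushforward_topology X q) \<subseteq> q ` topspace X"
    using openin_pushforward_topology[of X q] openin_topspace by blast
  have "{x \<in> topspace X. q x \<in> q ` topspace X} = topspace X"
    by auto
  then have "openin (pushforward_topology X q) (q ` topspace X)"
    by (simp add: openin_pushforward_topology)
  then show "q ` topspace X \<subseteq> topspace (pushforward_topology X q)"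
    by (rule openin_subset)
qed

lemma quotient_map_pushforward_topology: "quotient_map X (pushforward_topology X q) q"
  by (simp add: quotient_map_def topspace_pushforward_topology openin_pushforward_topology)

text \<open>Equal fibres let \<open>q'\<close> descend through \<open>q\<close> to a continuous
  \<open>h\<close>. As \<open>h \<circ> q\<close> agrees with the quotient map \<open>q'\<close>,
  \<open>h\<close> is itself a quotient map, and it is injective because the fibres are
  equal.\<close>

lemma quotient_maps_homeomorphic:
  assumes q: "quotient_map X E q" and q': "quotient_map X E' q'"
    and fib: "\<And>x y. \<lbrakk>x \<in> topspace X; y \<in> topspace X\<rbrakk> \<Longrightarrow> q x = q y \<longleftrightarrow> q' x = q' y"
  obtains h where "homeomorphic_map E E' h" "\<And>x. x \<in> topspace X \<Longrightarrow> h (q x) = q' x"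
proof -
  obtain h where h: "continuous_map E E' h" "\<And>x. x \<in> topspace X \<Longrightarrow> h (q x) = q' x"
    using quotient_map_lift_exists[OF q quotient_imp_continuous_map[OF q']] fib by metis
  have "quotient_map X E' (h \<circ> q)"
    using quotient_map_eq[OF q', of "h \<circ> q"] h(2) by simp
  then have "quotient_map E E' h"
    using quotient_map_compose_eq[OF q] by blast
  moreover have "inj_on h (topspace E)"
    unfolding quotient_imp_surjective_map[OF q, symmetric]
    using h(2) fib by (auto simp: inj_on_def)
  ultimately show ?thesis
    using that h(2) by (simp add: homeomorphic_map_def)
qed

section \<open>Existence and uniqueness of the factorization\<close>

lemma germ_factorization:
  assumes q: "continuous_map X E q" "open_map X E q"
    and eq: "\<And>x. x \<in> topspace X \<Longrightarrow> f x = p (q x)" and x: "x \<in> topspace X"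
  shows "germ E p (q x) = germ X f x"
proof -
  \<comment> \<open>\<open>f\<close> and \<open>p \<circ> q\<close> agree only on
    \<open>topspace X\<close>, so their image filters are compared through agreement near
    \<open>x\<close>.\<close>
  have "eventually (\<lambda>z. f z = p (q z)) (nhdsin X x)"
    using eq x unfolding eventually_nhdsin by blast
  then have "filtermap f (nhdsin X x) = filtermap (\<lambda>z. p (q z)) (nhdsin X x)"
    by (auto simp: filter_eq_iff eventually_filtermap elim: eventually_elim2)
  also have "\<dots> = filtermap p (nhdsin E (q x))"
    using filtermap_nhdsin_open_map[OF q x] by (metis filtermap_filtermap)
  finally show ?thesis
    using eq x by (simp add: germ_def)
qed

lemma filtered_map_germ:
  "filtered_map X Y f \<longleftrightarrow>
     continuous_map X Y f \<and> locally_open_onto_image X Y f \<and> inj_on (germ X f) (topspace X)"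
  by (simp add: filtered_map_def germ_def[abs_def])

text \<open>The germ of \<open>p\<close> at \<open>q x\<close> is that of \<open>f\<close> at
  \<open>x\<close>, and \<open>p\<close> is filtered, so germs separate the points of
  \<open>E\<close>. The right-hand side depends on \<open>f\<close> alone, so all factorizations
  have the same fibres; uniqueness rests on this.\<close>

lemma open_filtered_factorization_fibres:
  assumes "open_filtered_factorization X Y f E q p" "x \<in> topspace X" "y \<in> topspace X"
  shows "q x = q y \<longleftrightarrow> germ X f x = germ X f y"
proof -
  have "germ E p (q z) = germ X f z" if "z \<in> topspace X" for z
    using assms(1) that germ_factorization[of X E q f p z]
    by (simp add: open_filtered_factorization_def)
  moreover have "inj_on (germ E p) (topspace E)" "q ` topspace X = topspace E"
    using assms(1) by (auto simp: open_filtered_factorization_def filtered_map_germ)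
  ultimately show ?thesis
    using assms(2,3) by (metis imageI inj_on_eq_iff)
qed

lemma open_filtered_factorization_quotient_map:
  assumes "open_filtered_factorization X Y f E q p"
  shows "quotient_map X E q"
  using assms by (simp add: open_filtered_factorization_def continuous_open_imp_quotient_map)

text \<open>The points of \<open>E\<close> are chosen representatives of the germ classes in
  \<open>X\<close>. Thus \<open>E\<close> has the type of \<open>X\<close>, and \<open>f\<close>
  itself serves as \<open>p\<close>, since a point and its representative have the same
  value.\<close>

lemma open_filtered_factorization_exists:
  fixes X :: "'a topology"
  assumes f: "continuous_map X Y f" "locally_open_onto_image X Y f"
  shows "\<exists>(E :: 'a topology) q p. open_filtered_factorization X Y f E q p"
proof -
  define q where "q x = (SOME y. y \<in> topspace X \<and> germ X f y = germ X f x)" for x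
  define E where "E = pushforward_topology X q"
  have q: "q x \<in> topspace X" "germ X f (q x) = germ X f x" if "x \<in> topspace X" for x
    using someI[of "\<lambda>y. y \<in> topspace X \<and> germ X f y = germ X f x" x] that
    by (auto simp: q_def)
  \<comment> \<open>Equal germs give the same predicate under \<open>SOME\<close>, hence literally
    the same representative.\<close>
  have q_eq: "q x = q y \<longleftrightarrow> germ X f x = germ X f y" if "x \<in> topspace X" "y \<in> topspace X" for x y
    using q that by (metis q_def)
  have fq: "f x = f (q x)" if "x \<in> topspace X" for x
    using q(2)[OF that] by (simp add: germ_def)
  have quot: "quotient_map X E q"
    by (simp add: E_def quotient_map_pushforward_topology)
  have cont_q: "continuous_map X E q" and surj: "q ` topspace X = topspace E"
    using quot by (auto simp: quotient_imp_continuous_map quotient_imp_surjective_map)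
  have open_q: "open_map X E q"
    unfolding open_map_def
  proof (intro allI impI)
    fix U assume U: "openin X U"
    then have sub: "U \<subseteq> topspace X"
      by (rule openin_subset)
    \<comment> \<open>The preimage of the image of \<open>U\<close> under \<open>q\<close> is the
      saturation of \<open>U\<close>, which is already known to be open.\<close>
    have "q y \<in> q ` U \<longleftrightarrow> (\<exists>x\<in>U. germ X f x = germ X f y)" if "y \<in> topspace X" for y
      using q_eq[OF that] sub by (force simp: image_iff)
    then have "{x \<in> topspace X. q x \<in> q ` U} = {y \<in> topspace X. \<exists>x\<in>U. germ X f x = germ X f y}"
      by auto
    then show "openin E (q ` U)"
      using germ_openin_saturation[OF f U] sub
      by (auto simp: E_def openin_pushforward_topology)
  qed
  have "filtered_map E Y f"
    unfolding filtered_map_germ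
  proof (intro conjI)
    have "continuous_map X Y (f \<circ> q)"
      using continuous_map_eq[OF f(1), of "f \<circ> q"] fq by simp
    then show "continuous_map E Y f"
      using continuous_compose_quotient_map[OF quot] by blast
    show "inj_on (germ E f) (topspace E)"
      unfolding surj[symmetric]
    proof (clarsimp simp: inj_on_def)
      fix x y
      assume xy: "x \<in> topspace X" "y \<in> topspace X" and "germ E f (q x) = germ E f (q y)"
      \<comment> \<open>\<open>q\<close> is continuous and open, so germs on \<open>E\<close> can be
        read off on \<open>X\<close>, where \<open>q_eq\<close> applies.\<close>
      then show "q x = q y"
        using germ_factorization[of X E q f f, OF cont_q open_q fq] q_eq by metis
    qed
    show "locally_open_onto_image E Y f"
      unfolding locally_open_onto_image_def surj[symmetric]
    proof (clarify)
      fix x assume x: "x \<in> topspace X"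
      then obtain U where U: "openin X U" "x \<in> U"
          "open_map (subtopology X U) (subtopology Y (f ` U)) f"
        using f(2) unfolding locally_open_onto_image_def by blast
      have sub: "U \<subseteq> topspace X"
        using U(1) by (rule openin_subset)
      have img: "f ` q ` A = f ` A" if "A \<subseteq> topspace X" for A
        unfolding image_image using fq that by (intro image_cong refl) (metis subsetD)
      have oU: "openin E (q ` U)"
        using open_q U(1) by (simp add: open_map_def)
      have "open_map (subtopology E (q ` U)) (subtopology Y (f ` q ` U)) f"
        unfolding open_map_def
      proof (intro allI impI)
        fix W assume W: "openin (subtopology E (q ` U)) W"
        then have W': "openin E W" "W \<subseteq> q ` U"
          using oU by (auto simp: openin_open_subtopology)
        \<comment> \<open>\<open>W\<close> is pulled back to an open part of \<open>U\<close>, where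
          \<open>f\<close> is open onto its image. Since \<open>W\<close> lies in the image of
          \<open>U\<close>, \<open>q\<close> maps \<open>?V\<close> onto \<open>W\<close>, so
          \<open>?V\<close> and \<open>W\<close> have the same image under \<open>f\<close>.\<close>
        let ?V = "U \<inter> {z \<in> topspace X. q z \<in> W}"
        have "openin X ?V"
          using U(1) openin_continuous_map_preimage[OF cont_q W'(1)] by auto
        then have "openin (subtopology Y (f ` U)) (f ` ?V)"
          using U(1,3) by (auto simp: open_map_def openin_open_subtopology)
        moreover have "q ` ?V = W"
          using W'(2) sub by auto
        then have "f ` ?V = f ` W"
          using img[of ?V] by auto
        ultimately show "openin (subtopology Y (f ` q ` U)) (f ` W)"
          by (simp add: img[OF sub])
      qed
      with oU U(2) show "\<exists>V. openin E V \<and> q x \<in> V \<and>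
          open_map (subtopology E V) (subtopology Y (f ` V)) f"
        by blast
    qed
  qed
  then have "open_filtered_factorization X Y f E q f"
    using cont_q open_q surj fq unfolding open_filtered_factorization_def by blast
  then show ?thesis
    by blast
qed

text \<open>Both \<open>q\<close> and \<open>q'\<close> are quotient maps whose fibres are the germ
  classes of \<open>f\<close>, which gives \<open>h\<close>. Surjectivity of \<open>q\<close> then
  carries the relation between \<open>p\<close> and \<open>p'\<close> over to all of
  \<open>E\<close>.\<close>

lemma open_filtered_factorization_unique:
  assumes F: "open_filtered_factorization X Y f E q p"
    and F': "open_filtered_factorization X Y f E' q' p'"
  shows "\<exists>h. homeomorphic_map E E' h \<and> (\<forall>x \<in> topspace X. q' x = h (q x)) \<and>
    (\<forall>e \<in> topspace E. p e = p' (h e))"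
proof -
  obtain h where h: "homeomorphic_map E E' h" "\<And>x. x \<in> topspace X \<Longrightarrow> h (q x) = q' x"
    using quotient_maps_homeomorphic[of X E q E' q']
      open_filtered_factorization_quotient_map[OF F] open_filtered_factorization_quotient_map[OF F']
      open_filtered_factorization_fibres[OF F] open_filtered_factorization_fibres[OF F']
    by metis
  have "p e = p' (h e)" if "e \<in> topspace E" for e
  proof -
    obtain x where "x \<in> topspace X" "e = q x"
      using \<open>e \<in> topspace E\<close> F by (auto simp: open_filtered_factorization_def)
    then show ?thesis
      using F F' h(2) by (simp add: open_filtered_factorization_def)
  qed
  with h show ?thesis
    by metis
qed

lemma filtered_map_local_homeomorphism:
  assumes "filtered_map X Y f" "x \<in> topspace X"
  shows "\<exists>U. openin X U \<and> x \<in> U \<and> homeomorphic_map (subtopology X U) (subtopology Y (f ` U)) f"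
proof -
  have cont: "continuous_map X Y f" and inj: "inj_on (germ X f) (topspace X)"
    using assms(1) by (auto simp: filtered_map_germ)
  obtain U where U: "openin X U" "x \<in> U" "open_map (subtopology X U) (subtopology Y (f ` U)) f"
    using assms unfolding filtered_map_germ locally_open_onto_image_def by blast
  have sub: "U \<subseteq> topspace X"
    using U(1) by (rule openin_subset)
  \<comment> \<open>Both image filters are the neighbourhood filter of the common value in the image
    of \<open>U\<close>. Points of \<open>U\<close> with equal values thus have equal germs, and
    filteredness makes \<open>f\<close> injective on \<open>U\<close>.\<close>
  have "germ X f y = germ X f z" if "y \<in> U" "z \<in> U" "f y = f z" for y z
    using filtermap_nhdsin_locally_open[OF cont U(1) _ U(3)] that by (simp add: germ_def)
  then have "inj_on f U"
    using inj sub by (meson inj_onD inj_onI subsetD)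
  moreover have "continuous_map (subtopology X U) (subtopology Y (f ` U)) f"
    using cont by (auto simp: continuous_map_in_subtopology continuous_map_from_subtopology)
  moreover have "f ` U \<subseteq> topspace Y"
    using sub continuous_map_image_subset_topspace[OF cont] by blast
  ultimately have "homeomorphic_map (subtopology X U) (subtopology Y (f ` U)) f"
    using U(3) sub by (intro bijective_open_imp_homeomorphic_map) (auto simp: Int_absorb1)
  with U show ?thesis
    by blast
qed

theorem proposition5:
  fixes X :: "'a topology" and Y :: "'b topology" and f :: "'a \<Rightarrow> 'b"
  assumes "continuous_map X Y f"
    and "locally_open_onto_image X Y f"
  shows "(\<exists>(E :: 'a topology) q p. open_filtered_factorization X Y f E q p) \<and>
    (\<forall>(E :: 'c topology) q p (E' :: 'd topology) q' p'.
       open_filtered_factorization X Y f E q p \<and> open_filtered_factorization X Y f E' q' p' \<longrightarrow>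
       (\<exists>h. homeomorphic_map E E' h \<and>
          (\<forall>x \<in> topspace X. q' x = h (q x)) \<and>
          (\<forall>e \<in> topspace E. p e = p' (h e)))) \<and>
    (filtered_map X Y f \<longrightarrow>
       (\<forall>x \<in> topspace X. \<exists>U. openin X U \<and> x \<in> U \<and>
          homeomorphic_map (subtopology X U) (subtopology Y (f ` U)) f))"
proof (intro conjI)
  show "\<exists>(E :: 'a topology) q p. open_filtered_factorization X Y f E q p"
    using assms by (rule open_filtered_factorization_exists)
  show "\<forall>(E :: 'c topology) q p (E' :: 'd topology) q' p'.
       open_filtered_factorization X Y f E q p \<and> open_filtered_factorization X Y f E' q' p' \<longrightarrow>
       (\<exists>h. homeomorphic_map E E' h \<and>
          (\<forall>x \<in> topspace X. q' x = h (q x)) \<and>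
          (\<forall>e \<in> topspace E. p e = p' (h e)))"
    by (intro allI impI, elim conjE) (rule open_filtered_factorization_unique)
  show "filtered_map X Y f \<longrightarrow>
       (\<forall>x \<in> topspace X. \<exists>U. openin X U \<and> x \<in> U \<and>
          homeomorphic_map (subtopology X U) (subtopology Y (f ` U)) f)"
    by (intro impI ballI) (rule filtered_map_local_homeomorphism)
qed

end
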